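(* Let $(M,g)$ be the Robinson–Trautman spacetime with coordinates $(t,r,x,y)$, constants $a,b,d\in\mathbb R$ and function $f=f(x,y)$, and let $F_1=f_x^2+f_y^2-f(f_{xx}+f_{yy})$. If $b=0$, and on all of $M$ one has $F_1-2a\neq0$, $rF_1+6d-2ar\neq0$ and $$(-12d+8ar)f_x-4rf_y^2f_x+3rff_{yy}f_x-4rf_x^3+2rff_yf_{xy}-rf^2f_{xyy}+5rff_xf_{xx}-rf^2f_{xxx}=0,$$ then the spacetime admits curvature collineation with respect to $\xi=\frac{\partial}{\partial x}$, i.e. $\mathscr L_\xi R=0$.
   Context: Robinson–Trautman (RT) spacetime: $a,b,d\in\mathbb R$ are constants; $M=I\times J\times\Omega$ with coordinates $(x^1,x^2,x^3,x^4)=(t,r,x,y)$, where $I\subset\mathbb R$ and $J\subset\mathbb R\setminus\{0\}$ are nonempty open intervals and $\Omega\subset\mathbb R^2$ is open, connected and nonempty; $f:\Omega\to\mathbb R$ is smooth and nowhere vanishing, with subscripts denoting partial derivatives; the metric is $$g=-2\Big(a-2br-\frac dr\Big)dt^2+2\,dt\,dr-\frac{r^2}{f^2}(dx^2+dy^2).$$ ($2\,dt\,dr$ means $g_{12}=g_{21}=1$.) Curvature convention: with $\Gamma$ the Levi-Civita connection coefficients, $R_{pqrs}=g_{p\alpha}(\partial_r\Gamma^\alpha_{qs}-\partial_s\Gamma^\alpha_{qr}+\Gamma^\beta_{qs}\Gamma^\alpha_{\beta r}-\Gamma^\beta_{qr}\Gamma^\alpha_{\beta s})$ (type $(0,4)$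 Riemann tensor); $\mathscr L_\xi$ is the Lie derivative of the $(0,4)$ tensor. *)

theory Defs
  imports "HOL-Analysis.Analysis"
begin

section \<open>Partial derivatives and smooth functions on \<open>\<real>\<^sup>n\<close>\<close>

definition partial :: "'n::finite \<Rightarrow> (real^'n \<Rightarrow> real) \<Rightarrow> real^'n \<Rightarrow> real" where
  "partial i F p = deriv (\<lambda>s. F (p + s *\<^sub>R axis i 1)) 0"

definition has_partial :: "'n::finite \<Rightarrow> (real^'n \<Rightarrow> real) \<Rightarrow> real^'n \<Rightarrow> bool" where
  "has_partial i F p \<longleftrightarrow> (\<lambda>s. F (p + s *\<^sub>R axis i 1)) differentiable (at 0)"

text \<open>
  The order of the list is that of subscripts: \<open>partials [1, 2, 2] f\<close> is
  \<open>f\<^sub>x\<^sub>y\<^sub>y\<close>, the derivative with respect to the first variable being taken first.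
\<close>

primrec partials :: "'n::finite list \<Rightarrow> (real^'n \<Rightarrow> real) \<Rightarrow> real^'n \<Rightarrow> real" where
  "partials [] F = F"
| "partials (i # is) F = partials is (partial i F)"

text \<open>
  Only used for open \<open>S\<close>; then the partial derivatives at points of \<open>S\<close> do not depend on
  the values of \<open>F\<close> outside \<open>S\<close>.
\<close>

definition smooth_on :: "(real^'n::finite) set \<Rightarrow> (real^'n \<Rightarrow> real) \<Rightarrow> bool" where
  "smooth_on S F \<longleftrightarrow>
     (\<forall>is. continuous_on S (partials is F) \<and>
           (\<forall>i. \<forall>p\<in>S. has_partial i (partials is F) p))"


section \<open>Curvature of a metric in a coordinate chart\<close>

definition christoffel ::
  "(real^'n::finite \<Rightarrow> real^'n^'n) \<Rightarrow> 'n \<Rightarrow> 'n \<Rightarrow> 'n \<Rightarrow> real^'n \<Rightarrow> real" where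
  \<comment> \<open>\<open>christoffel g i j k\<close> is \<open>\<Gamma>\<^sup>i\<^bsub>jk\<^esub>\<close>, the upper index first\<close>
  "christoffel g i j k p =
     (1/2) * (\<Sum>l\<in>UNIV. matrix_inv (g p) $ i $ l *
       (partial j (\<lambda>q. g q $ l $ k) p + partial k (\<lambda>q. g q $ l $ j) p
        - partial l (\<lambda>q. g q $ j $ k) p))"

definition riemann ::
  "(real^'n::finite \<Rightarrow> real^'n^'n) \<Rightarrow> 'n \<Rightarrow> 'n \<Rightarrow> 'n \<Rightarrow> 'n \<Rightarrow> real^'n \<Rightarrow> real" where
  "riemann g i j k l p =
     (\<Sum>\<alpha>\<in>UNIV. g p $ i $ \<alpha> *
       (partial k (christoffel g \<alpha> j l) p - partial l (christoffel g \<alpha> j k) p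
        + (\<Sum>\<beta>\<in>UNIV. christoffel g \<beta> j l p * christoffel g \<alpha> \<beta> k p)
        - (\<Sum>\<beta>\<in>UNIV. christoffel g \<beta> j k p * christoffel g \<alpha> \<beta> l p)))"

definition lie_derivative4 ::
  "(real^'n::finite \<Rightarrow> real^'n) \<Rightarrow> ('n \<Rightarrow> 'n \<Rightarrow> 'n \<Rightarrow> 'n \<Rightarrow> real^'n \<Rightarrow> real)
    \<Rightarrow> 'n \<Rightarrow> 'n \<Rightarrow> 'n \<Rightarrow> 'n \<Rightarrow> real^'n \<Rightarrow> real" where
  "lie_derivative4 \<xi> T i j k l p =
     (\<Sum>m\<in>UNIV. \<xi> p $ m * partial m (T i j k l) p
        + T m j k l p * partial i (\<lambda>q. \<xi> q $ m) p
        + T i m k l p * partial j (\<lambda>q. \<xi> q $ m) p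
        + T i j m l p * partial k (\<lambda>q. \<xi> q $ m) p
        + T i j k m p * partial l (\<lambda>q. \<xi> q $ m) p)"

definition curvature_collineation ::
  "(real^'n::finite) set \<Rightarrow> (real^'n \<Rightarrow> real^'n^'n) \<Rightarrow> (real^'n \<Rightarrow> real^'n) \<Rightarrow> bool" where
  "curvature_collineation M g \<xi> \<longleftrightarrow>
     (\<forall>p\<in>M. \<forall>i j k l. lie_derivative4 \<xi> (riemann g) i j k l p = 0)"


section \<open>The Robinson--Trautman spacetime\<close>

text \<open>
  Points of \<open>M\<close> are \<open>p = (t, r, x, y)\<close>, with \<open>t = p $ 1\<close>, \<open>r = p $ 2\<close>; the
  function \<open>f\<close> is defined on all of \<open>\<real>\<^sup>2\<close>, but only its values on \<open>\<Omega>\<close> matter.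
\<close>

definition rt_xy :: "real^4 \<Rightarrow> real^2" where
  "rt_xy p = vector [p $ 3, p $ 4]"

definition rt_domain :: "real set \<Rightarrow> real set \<Rightarrow> (real^2) set \<Rightarrow> (real^4) set" where
  "rt_domain I J \<Omega> = {p. p $ 1 \<in> I \<and> p $ 2 \<in> J \<and> rt_xy p \<in> \<Omega>}"

definition rt_metric ::
  "real \<Rightarrow> real \<Rightarrow> real \<Rightarrow> (real^2 \<Rightarrow> real) \<Rightarrow> real^4 \<Rightarrow> real^4^4" where
  "rt_metric a b d f p =
     (let r = p $ 2; h = - (r^2 / (f (rt_xy p))^2) in
      vector [vector [- 2 * (a - 2 * b * r - d / r), 1, 0, 0],
              vector [1, 0, 0, 0],
              vector [0, 0, h, 0],
              vector [0, 0, 0, h]])"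

definition rt_F1 :: "(real^2 \<Rightarrow> real) \<Rightarrow> real^2 \<Rightarrow> real" where
  "rt_F1 f q = (partials [1] f q)^2 + (partials [2] f q)^2
     - f q * (partials [1,1] f q + partials [2,2] f q)"

text \<open>The coordinate vector field \<open>\<partial>/\<partial>x\<close>; \<open>x\<close> is the third coordinate.\<close>

definition rt_dx :: "real^4 \<Rightarrow> real^4" where
  "rt_dx p = axis 3 1"

end

theory Submission
  imports Defs
begin

text \<open>
  The field \<open>\<partial>/\<partial>x\<close> has constant components, so the Lie derivative of the curvature along it is
  just \<open>\<partial>/\<partial>x\<close> of each component, and everything depends on how the components of the
  Riemann tensor depend on \<open>x\<close>. For \<open>b = 0\<close> the tensor can be written out completely
  (\<open>riemann_rt_metric\<close>). With \<open>r\<close> held fixed, each component is a constant plus a linear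
  combination of the three functions \<open>d/f\<^sup>2\<close>, \<open>d/f\<^sup>4\<close> and \<open>(F\<^sub>1 - 2a)/f\<^sup>4\<close>, whose coefficients
  do not involve \<open>x\<close> and \<open>y\<close> (\<open>rt_riemann_decompose\<close>). Hence the field is a curvature
  collineation as soon as these three functions do not depend on \<open>x\<close>
  (\<open>curvature_collineation_rt_dxI\<close>).

  The differential equation in the hypothesis gives exactly this. Neither \<open>f\<close> nor its derivatives
  depend on \<open>r\<close>, so at a fixed point of \<open>\<Omega>\<close> the equation says that a polynomial
  \<open>A + r B\<close> vanishes for all \<open>r\<close> in an open interval, which forces \<open>A = 0\<close> and \<open>B = 0\<close>. The first
  coefficient is \<open>A = -12 d f\<^sub>x\<close>, and \<open>d f\<^sub>x = 0\<close> makes \<open>d/f\<^sup>2\<close> and \<open>d/f\<^sup>4\<close> independent of \<open>x\<close>.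
  The second coefficient is \<open>B = f\<^sup>5 \<cdot> \<partial>((F\<^sub>1 - 2a)/f\<^sup>4)/\<partial>x\<close> (\<open>angular_curvature_x_derivative\<close>).

  Two of these computations rely on the symmetry of mixed partial derivatives
  (\<open>partial_commute\<close>): the terms \<open>\<partial>\<^sub>x\<Gamma>\<close> and \<open>\<partial>\<^sub>y\<Gamma>\<close> in the Riemann tensor contain \<open>f\<^sub>x\<^sub>y\<close> and
  \<open>f\<^sub>y\<^sub>x\<close>, which have to cancel, and \<open>\<partial>F\<^sub>1/\<partial>x\<close> contains \<open>f\<^sub>y\<^sub>y\<^sub>x\<close>, while the equation contains
  \<open>f\<^sub>x\<^sub>y\<^sub>y\<close>.
\<close>


section \<open>Partial derivatives of smooth functions\<close>

lemma smooth_on_partial: "smooth_on S F \<Longrightarrow> smooth_on S (partial i F)"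
  unfolding smooth_on_def by (metis partials.simps(2))

lemma smooth_on_partials: "smooth_on S F \<Longrightarrow> smooth_on S (partials is F)"
  by (induction "is" arbitrary: F) (auto intro: smooth_on_partial)

lemma smooth_on_continuous: "smooth_on S F \<Longrightarrow> continuous_on S F"
  unfolding smooth_on_def by (metis partials.simps(1))

lemma partial_eqI:
  assumes "((\<lambda>s. F (p + s *\<^sub>R axis i 1)) has_field_derivative D) (at 0)"
  shows "partial i F p = D"
  using assms unfolding partial_def by (rule DERIV_imp_deriv)

text \<open>
  The definition of \<open>partial\<close> differentiates at parameter \<open>0\<close>. The mean value theorem needs the
  derivative at every point of a coordinate line, which follows by moving the base point.
\<close>

lemma smooth_on_line_derivative:
  assumes "smooth_on S F" "p + s *\<^sub>R axis i 1 \<in> S"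
  shows "((\<lambda>s. F (p + s *\<^sub>R axis i 1)) has_field_derivative
           partial i F (p + s *\<^sub>R axis i 1)) (at s)"
proof -
  let ?q = "p + s *\<^sub>R axis i 1"
  have "has_partial i F ?q"
    using assms unfolding smooth_on_def by (metis partials.simps(1))
  then have "((\<lambda>h. F (?q + h *\<^sub>R axis i 1)) has_field_derivative partial i F ?q) (at 0)"
    unfolding has_partial_def partial_def by (simp add: DERIV_deriv_iff_real_differentiable)
  then have "((\<lambda>h. F (p + (h + s) *\<^sub>R axis i 1)) has_field_derivative partial i F ?q) (at 0)"
    by (simp add: algebra_simps)
  then show ?thesis
    using DERIV_shift[of "\<lambda>s. F (p + s *\<^sub>R axis i 1)" "partial i F ?q" 0 s] by simp
qed

lemma eventually_line:
  fixes p :: "real^'n::finite"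
  assumes "open S" "p \<in> S"
  shows "\<forall>\<^sub>F s in nhds 0. p + s *\<^sub>R axis i 1 \<in> S"
proof -
  have "((\<lambda>s. p + s *\<^sub>R axis i (1::real)) \<longlongrightarrow> p + 0 *\<^sub>R axis i 1) (nhds 0)"
    by (intro tendsto_intros filterlim_ident)
  then show ?thesis
    using assms by (auto dest: topological_tendstoD)
qed

lemma partial_cong_on_open:
  assumes "open S" "p \<in> S" "\<And>q. q \<in> S \<Longrightarrow> F q = G q"
  shows "partial i F p = partial i G p"
  unfolding partial_def
proof (rule deriv_cong_ev)
  show "\<forall>\<^sub>F s in nhds 0. F (p + s *\<^sub>R axis i 1) = G (p + s *\<^sub>R axis i 1)"
    using eventually_line[OF assms(1,2)] by eventually_elim (use assms(3) in auto)
qed simp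

text \<open>
  The mean value theorem, applied first in direction \<open>i\<close> to the difference of \<open>F\<close> along two
  opposite sides of a coordinate square and then in direction \<open>j\<close>, turns the second difference of
  \<open>F\<close> over the square into a value of one mixed derivative. The left-hand side is symmetric in \<open>i\<close>
  and \<open>j\<close>, which is what makes the mixed derivatives comparable.
\<close>

lemma second_difference_mean_value:
  fixes F :: "real^'n::finite \<Rightarrow> real"
  assumes "smooth_on S F" "h > 0"
    and box: "\<And>s t. 0 \<le> s \<Longrightarrow> s \<le> h \<Longrightarrow> 0 \<le> t \<Longrightarrow> t \<le> h \<Longrightarrow>
                p + s *\<^sub>R axis i 1 + t *\<^sub>R axis j 1 \<in> S"
  obtains s t where "0 < s" "s < h" "0 < t" "t < h"
    "F (p + h *\<^sub>R axis i 1 + h *\<^sub>R axis j 1) - F (p + h *\<^sub>R axis i 1)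
       - F (p + h *\<^sub>R axis j 1) + F p
     = h\<^sup>2 * partial j (partial i F) (p + s *\<^sub>R axis i 1 + t *\<^sub>R axis j 1)"
proof -
  define u where "u s = F (p + h *\<^sub>R axis j 1 + s *\<^sub>R axis i 1) - F (p + s *\<^sub>R axis i 1)" for s
  define u' where "u' s = partial i F (p + h *\<^sub>R axis j 1 + s *\<^sub>R axis i 1)
    - partial i F (p + s *\<^sub>R axis i 1)" for s
  have "(u has_field_derivative u' s) (at s)" if "0 \<le> s" "s \<le> h" for s
    unfolding u_def u'_def
    using box[of s h] box[of s 0] that \<open>h > 0\<close>
    by (intro DERIV_diff smooth_on_line_derivative[OF assms(1)]) (auto simp: algebra_simps)
  then obtain s where s: "0 < s" "s < h" "u h - u 0 = (h - 0) * u' s"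
    using MVT2[of 0 h u u'] \<open>h > 0\<close> by blast
  define v where "v t = partial i F (p + s *\<^sub>R axis i 1 + t *\<^sub>R axis j 1)" for t
  define v' where "v' t = partial j (partial i F) (p + s *\<^sub>R axis i 1 + t *\<^sub>R axis j 1)" for t
  have "(v has_field_derivative v' t) (at t)" if "0 \<le> t" "t \<le> h" for t
    unfolding v_def v'_def
    using box[of s t] that s
    by (intro smooth_on_line_derivative[OF smooth_on_partial[OF assms(1)]]) auto
  then obtain t where t: "0 < t" "t < h" "v h - v 0 = (h - 0) * v' t"
    using MVT2[of 0 h v v'] \<open>h > 0\<close> by blast
  have "u' s = v h - v 0"
    by (simp add: u'_def v_def algebra_simps)
  then have "u h - u 0 = h\<^sup>2 * v' t"
    using s t by (simp add: power2_eq_square)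
  then show ?thesis
    using that[OF s(1,2) t(1,2)] by (simp add: u_def v'_def algebra_simps)
qed

text \<open>
  Over small squares at \<open>p\<close> the same second difference equals \<open>h\<^sup>2\<close> times a value of either mixed
  derivative. If these derivatives differed at \<open>p\<close>, continuity would keep their values on a
  small enough square apart.
\<close>

lemma partial_commute:
  fixes F :: "real^'n::finite \<Rightarrow> real"
  assumes "open S" "smooth_on S F" "p \<in> S"
  shows "partial i (partial j F) p = partial j (partial i F) p"
proof (rule ccontr)
  define A where "A = partial i (partial j F)"
  define B where "B = partial j (partial i F)"
  assume "partial i (partial j F) p \<noteq> partial j (partial i F) p"
  then have ne: "A p \<noteq> B p" by (simp add: A_def B_def)
  have cont: "isCont A p" "isCont B p"
    using assms unfolding A_def B_def
    by (metis continuous_on_eq_continuous_at smooth_on_continuous smooth_on_partial)+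
  define \<epsilon> where "\<epsilon> = \<bar>A p - B p\<bar> / 2"
  have "\<epsilon> > 0" using ne by (simp add: \<epsilon>_def)
  obtain e1 where e1: "e1 > 0" "\<And>q. dist q p < e1 \<Longrightarrow> \<bar>A q - A p\<bar> < \<epsilon>"
    using cont(1) \<open>\<epsilon> > 0\<close> unfolding continuous_at_eps_delta dist_real_def by blast
  obtain e2 where e2: "e2 > 0" "\<And>q. dist q p < e2 \<Longrightarrow> \<bar>B q - B p\<bar> < \<epsilon>"
    using cont(2) \<open>\<epsilon> > 0\<close> unfolding continuous_at_eps_delta dist_real_def by blast
  obtain e3 where e3: "e3 > 0" "\<And>q. dist q p < e3 \<Longrightarrow> q \<in> S"
    using assms(1,3) unfolding open_dist by blast
  \<comment> \<open>a point of the square is at distance at most \<open>2 h\<close> from \<open>p\<close>\<close>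
  define h where "h = min e1 (min e2 e3) / 3"
  have "h > 0" using e1 e2 e3 by (simp add: h_def)
  have near: "dist (p + s *\<^sub>R axis k 1 + t *\<^sub>R axis l 1) p < min e1 (min e2 e3)"
    if "0 \<le> s" "s \<le> h" "0 \<le> t" "t \<le> h" for s t :: real and k l :: 'n
  proof -
    have "dist (p + s *\<^sub>R axis k 1 + t *\<^sub>R axis l 1) p = norm (s *\<^sub>R axis k 1 + t *\<^sub>R axis l (1::real))"
      by (simp add: dist_norm)
    also have "\<dots> \<le> s + t"
      using norm_triangle_ineq[of "s *\<^sub>R axis k (1::real)" "t *\<^sub>R axis l 1"] that
      by (simp add: norm_axis_1)
    also have "\<dots> < min e1 (min e2 e3)" using that \<open>h > 0\<close> by (simp add: h_def)
    finally show ?thesis .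
  qed
  obtain s t where st: "0 < s" "s < h" "0 < t" "t < h"
    "F (p + h *\<^sub>R axis i 1 + h *\<^sub>R axis j 1) - F (p + h *\<^sub>R axis i 1)
       - F (p + h *\<^sub>R axis j 1) + F p = h\<^sup>2 * B (p + s *\<^sub>R axis i 1 + t *\<^sub>R axis j 1)"
    unfolding B_def
    by (rule second_difference_mean_value[OF assms(2) \<open>h > 0\<close>, of p i j]) (use near e3(2) in auto)
  obtain s' t' where st': "0 < s'" "s' < h" "0 < t'" "t' < h"
    "F (p + h *\<^sub>R axis j 1 + h *\<^sub>R axis i 1) - F (p + h *\<^sub>R axis j 1)
       - F (p + h *\<^sub>R axis i 1) + F p = h\<^sup>2 * A (p + s' *\<^sub>R axis j 1 + t' *\<^sub>R axis i 1)"
    unfolding A_def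
    by (rule second_difference_mean_value[OF assms(2) \<open>h > 0\<close>, of p j i]) (use near e3(2) in auto)
  have "h\<^sup>2 * A (p + s' *\<^sub>R axis j 1 + t' *\<^sub>R axis i 1)
      = h\<^sup>2 * B (p + s *\<^sub>R axis i 1 + t *\<^sub>R axis j 1)"
    unfolding st(5)[symmetric] st'(5)[symmetric] by (simp add: algebra_simps)
  then have eq: "A (p + s' *\<^sub>R axis j 1 + t' *\<^sub>R axis i 1) = B (p + s *\<^sub>R axis i 1 + t *\<^sub>R axis j 1)"
    using \<open>h > 0\<close> by simp
  have "\<bar>A (p + s' *\<^sub>R axis j 1 + t' *\<^sub>R axis i 1) - A p\<bar> < \<epsilon>"
    using near[of s' t' j i] st' e1(2) by simp
  moreover have "\<bar>B (p + s *\<^sub>R axis i 1 + t *\<^sub>R axis j 1) - B p\<bar> < \<epsilon>"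
    using near[of s t i j] st e2(2) by simp
  ultimately have "\<bar>A p - B p\<bar> < \<epsilon> + \<epsilon>"
    unfolding eq by linarith
  then show False
    by (simp add: \<epsilon>_def)
qed

section \<open>The coordinate chart and the derivatives of its functions\<close>

lemma vector_4 [simp]:
  "(vector [x, y, z, w] :: 'a::zero^4) $ 1 = x"
  "(vector [x, y, z, w] :: 'a::zero^4) $ 2 = y"
  "(vector [x, y, z, w] :: 'a::zero^4) $ 3 = z"
  "(vector [x, y, z, w] :: 'a::zero^4) $ 4 = w"
  unfolding vector_def by simp_all

lemma rt_xy_line:
  "rt_xy (p + s *\<^sub>R axis l 1) =
     (if l = 3 then rt_xy p + s *\<^sub>R axis 1 1
      else if l = 4 then rt_xy p + s *\<^sub>R axis 2 1 else rt_xy p)"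
  by (auto simp: rt_xy_def vec_eq_iff forall_2 axis_def)

lemma open_rt_domain:
  assumes "open I" "open J" "open \<Omega>"
  shows "open (rt_domain I J \<Omega>)"
proof -
  have "rt_xy = (\<lambda>p. \<chi> i. if i = 1 then p $ 3 else p $ 4)"
    by (auto simp: fun_eq_iff rt_xy_def vec_eq_iff forall_2)
  moreover have "continuous_on UNIV (\<lambda>p::real^4. \<chi> i::2. if i = 1 then p $ 3 else p $ 4)"
  proof (rule continuous_on_vec_lambda)
    show "continuous_on UNIV (\<lambda>p::real^4. if i = 1 then p $ 3 else p $ 4)" for i :: 2
      by (cases "i = 1") (auto intro!: continuous_intros)
  qed
  ultimately have "open (rt_xy -` \<Omega>)"
    using assms(3) by (metis open_vimage)
  moreover have "open ((\<lambda>p::real^4. p $ 1) -` I)" "open ((\<lambda>p::real^4. p $ 2) -` J)"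
    using assms by (auto intro!: open_vimage continuous_intros)
  moreover have "rt_domain I J \<Omega> = (\<lambda>p. p $ 1) -` I \<inter> ((\<lambda>p. p $ 2) -` J \<inter> rt_xy -` \<Omega>)"
    by (auto simp: rt_domain_def)
  ultimately show ?thesis by auto
qed

text \<open>
  The chain rule for a function of \<open>(x, y)\<close> read as a function on the spacetime, in a form that is
  uniform in the coordinate index \<open>l\<close>.
\<close>

definition chart_partial :: "4 \<Rightarrow> (real^2 \<Rightarrow> real) \<Rightarrow> real^2 \<Rightarrow> real" where
  "chart_partial l F q = (if l = 3 then partial 1 F q else if l = 4 then partial 2 F q else 0)"

lemma has_derivative_rt_xy:
  assumes "smooth_on \<Omega> F" "rt_xy p \<in> \<Omega>"
  shows "((\<lambda>s. F (rt_xy (p + s *\<^sub>R axis l 1))) has_field_derivative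
           chart_partial l F (rt_xy p)) (at 0)"
  using smooth_on_line_derivative[OF assms(1), of "rt_xy p" 0 1]
    smooth_on_line_derivative[OF assms(1), of "rt_xy p" 0 2] assms(2)
  by (simp add: rt_xy_line chart_partial_def)

lemma has_derivative_radius:
  "((\<lambda>s. (p + s *\<^sub>R axis l 1) $ 2) has_field_derivative (if l = 2 then 1 else 0))
     (at (0::real))" for p :: "real^4"
  by (auto intro!: derivative_eq_intros simp: axis_def)


section \<open>The metric and its Christoffel symbols\<close>

lemma matrix_inv_eqI:
  fixes A B :: "real^'n^'n"
  assumes "A ** B = mat 1" "B ** A = mat 1"
  shows "matrix_inv A = B"
proof -
  have "invertible A" using assms unfolding invertible_def by blast
  then have "matrix_inv A ** A = mat 1"
    unfolding invertible_def matrix_inv_def by (rule someI2_ex) simp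
  then show ?thesis
    by (metis assms(1) matrix_mul_assoc matrix_mul_lid matrix_mul_rid)
qed

lemma rt_metric_nth:
  "rt_metric a 0 d f p $ i $ j =
     (if i = 1 \<and> j = 1 then - 2 * (a - d / (p $ 2))
      else if i = 1 \<and> j = 2 \<or> i = 2 \<and> j = 1 then 1
      else if i = j \<and> (i = 3 \<or> i = 4) then - ((p $ 2)\<^sup>2 / (f (rt_xy p))\<^sup>2) else 0)"
  using exhaust_4[of i] exhaust_4[of j] by (elim disjE) (simp_all add: rt_metric_def Let_def)

lemma matrix_inv_rt_metric:
  assumes "p $ 2 \<noteq> 0" "f (rt_xy p) \<noteq> 0"
  shows "matrix_inv (rt_metric a 0 d f p) $ i $ j =
     (if i = 2 \<and> j = 2 then 2 * (a - d / (p $ 2))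
      else if i = 1 \<and> j = 2 \<or> i = 2 \<and> j = 1 then 1
      else if i = j \<and> (i = 3 \<or> i = 4) then - ((f (rt_xy p))\<^sup>2 / (p $ 2)\<^sup>2) else 0)"
    (is "_ = ?B i j")
proof -
  have "matrix_inv (rt_metric a 0 d f p) = (\<chi> i j. ?B i j)"
    using assms
    by (intro matrix_inv_eqI)
      (simp_all add: vec_eq_iff matrix_matrix_mult_def mat_def rt_metric_nth sum_4 forall_4)
  then show ?thesis by simp
qed

text \<open>
  The derivative of the metric coefficients along a curve on which \<open>r\<close> and \<open>f\<close> have the values
  \<open>r\<close>, \<open>F\<close> and the velocities \<open>r'\<close>, \<open>F'\<close>. Treating the velocities as parameters covers all four
  coordinate directions at once.
\<close>

definition rt_metric_deriv ::
  "real \<Rightarrow> real \<Rightarrow> real \<Rightarrow> real \<Rightarrow> real \<Rightarrow> 4 \<Rightarrow> 4 \<Rightarrow> real" where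
  "rt_metric_deriv d r F r' F' i j =
     (if i = 1 \<and> j = 1 then - 2 * d * r' / r\<^sup>2
      else if i = j \<and> (i = 3 \<or> i = 4) then 2 * r\<^sup>2 * F' / F^3 - 2 * r * r' / F\<^sup>2
      else 0)"

lemma has_derivative_rt_metric_entries:
  assumes "(r has_field_derivative r') (at s)" "(F has_field_derivative F') (at s)"
    "r s \<noteq> 0" "F s \<noteq> 0"
  shows "((\<lambda>s. - 2 * (a - d / r s)) has_field_derivative - 2 * d * r' / (r s)\<^sup>2) (at s)"
    and "((\<lambda>s. - ((r s)\<^sup>2 / (F s)\<^sup>2)) has_field_derivative
           2 * (r s)\<^sup>2 * F' / F s^3 - 2 * r s * r' / (F s)\<^sup>2) (at s)"
  using assms(3,4)
  by (auto intro!: derivative_eq_intros assms(1,2) simp: field_simps eval_nat_numeral)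

lemma partial_rt_metric:
  assumes "p $ 2 \<noteq> 0" "smooth_on \<Omega> f" "rt_xy p \<in> \<Omega>" "f (rt_xy p) \<noteq> 0"
  shows "partial l (\<lambda>q. rt_metric a 0 d f q $ i $ j) p =
    rt_metric_deriv d (p $ 2) (f (rt_xy p)) (if l = 2 then 1 else 0) (chart_partial l f (rt_xy p)) i j"
proof (rule partial_eqI)
  note D = has_derivative_rt_metric_entries[OF has_derivative_radius[of p l]
      has_derivative_rt_xy[OF assms(2,3), of l], simplified, OF assms(1,4)]
  show "((\<lambda>s. rt_metric a 0 d f (p + s *\<^sub>R axis l 1) $ i $ j) has_field_derivative
    rt_metric_deriv d (p $ 2) (f (rt_xy p)) (if l = 2 then 1 else 0)
      (chart_partial l f (rt_xy p)) i j) (at 0)"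
    unfolding rt_metric_nth rt_metric_deriv_def
    using exhaust_4[of i] exhaust_4[of j] D
    by (elim disjE) simp_all
qed

text \<open>
  Here \<open>F\<close>, \<open>X\<close>, \<open>Y\<close> stand for the values of \<open>f\<close>, \<open>f\<^sub>x\<close>, \<open>f\<^sub>y\<close>, and the index \<open>i\<close> is the upper one.
  The term \<open>a - d / r\<close> is \<open>-g\<^sub>1\<^sub>1/2\<close>, and \<open>d / r\<^sup>2\<close> is its derivative in \<open>r\<close>.
\<close>

definition rt_christoffel ::
  "real \<Rightarrow> real \<Rightarrow> real \<Rightarrow> real \<Rightarrow> real \<Rightarrow> real \<Rightarrow> 4 \<Rightarrow> 4 \<Rightarrow> 4 \<Rightarrow> real" where
  "rt_christoffel a d r F X Y i j k =
    (if i = 1 then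
       if j = 1 \<and> k = 1 then d / r\<^sup>2
       else if j = k \<and> (j = 3 \<or> j = 4) then r / F\<^sup>2 else 0
     else if i = 2 then
       if j = 1 \<and> k = 1 then 2 * (a - d / r) * d / r\<^sup>2
       else if j = 1 \<and> k = 2 \<or> j = 2 \<and> k = 1 then - d / r\<^sup>2
       else if j = k \<and> (j = 3 \<or> j = 4) then 2 * (a * r - d) / F\<^sup>2 else 0
     else if i = 3 then
       if j = 2 \<and> k = 3 \<or> j = 3 \<and> k = 2 then 1 / r
       else if j = 3 \<and> k = 3 then - X / F
       else if j = 4 \<and> k = 4 then X / F
       else if j = 3 \<and> k = 4 \<or> j = 4 \<and> k = 3 then - Y / F else 0
     else
       if j = 2 \<and> k = 4 \<or> j = 4 \<and> k = 2 then 1 / r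
       else if j = 3 \<and> k = 3 then Y / F
       else if j = 4 \<and> k = 4 then - Y / F
       else if j = 3 \<and> k = 4 \<or> j = 4 \<and> k = 3 then - X / F else 0)"

text \<open>
  As for the metric, \<open>r'\<close>, \<open>F'\<close>, \<open>X'\<close>, \<open>Y'\<close> are the velocities of \<open>r\<close>, \<open>F\<close>, \<open>X\<close>, \<open>Y\<close> along a curve.
\<close>

definition rt_christoffel_deriv ::
  "real \<Rightarrow> real \<Rightarrow> real \<Rightarrow> real \<Rightarrow> real \<Rightarrow> real \<Rightarrow> real \<Rightarrow> real \<Rightarrow> real \<Rightarrow> real
     \<Rightarrow> 4 \<Rightarrow> 4 \<Rightarrow> 4 \<Rightarrow> real" where
  "rt_christoffel_deriv a d r F X Y r' F' X' Y' i j k =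
    (if i = 1 then
       if j = 1 \<and> k = 1 then - 2 * d * r' / r^3
       else if j = k \<and> (j = 3 \<or> j = 4) then r' / F\<^sup>2 - 2 * r * F' / F^3 else 0
     else if i = 2 then
       if j = 1 \<and> k = 1 then - 4 * a * d * r' / r^3 + 6 * d\<^sup>2 * r' / r^4
       else if j = 1 \<and> k = 2 \<or> j = 2 \<and> k = 1 then 2 * d * r' / r^3
       else if j = k \<and> (j = 3 \<or> j = 4) then 2 * a * r' / F\<^sup>2 - 4 * (a * r - d) * F' / F^3 else 0
     else if i = 3 then
       if j = 2 \<and> k = 3 \<or> j = 3 \<and> k = 2 then - r' / r\<^sup>2
       else if j = 3 \<and> k = 3 then X * F' / F\<^sup>2 - X' / F
       else if j = 4 \<and> k = 4 then X' / F - X * F' / F\<^sup>2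
       else if j = 3 \<and> k = 4 \<or> j = 4 \<and> k = 3 then Y * F' / F\<^sup>2 - Y' / F else 0
     else
       if j = 2 \<and> k = 4 \<or> j = 4 \<and> k = 2 then - r' / r\<^sup>2
       else if j = 3 \<and> k = 3 then Y' / F - Y * F' / F\<^sup>2
       else if j = 4 \<and> k = 4 then Y * F' / F\<^sup>2 - Y' / F
       else if j = 3 \<and> k = 4 \<or> j = 4 \<and> k = 3 then X * F' / F\<^sup>2 - X' / F else 0)"

lemma christoffel_rt_metric:
  assumes "p $ 2 \<noteq> 0" "smooth_on \<Omega> f" "rt_xy p \<in> \<Omega>" "f (rt_xy p) \<noteq> 0"
  shows "christoffel (rt_metric a 0 d f) i j k p =
    rt_christoffel a d (p $ 2) (f (rt_xy p)) (partial 1 f (rt_xy p)) (partial 2 f (rt_xy p)) i j k"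
  unfolding christoffel_def partial_rt_metric[OF assms] matrix_inv_rt_metric[of p f, OF assms(1,4)]
  using assms(1,4) exhaust_4[of i] exhaust_4[of j] exhaust_4[of k]
  by (elim disjE) (simp_all add: sum_4 rt_metric_deriv_def chart_partial_def rt_christoffel_def
      field_simps power2_eq_square power3_eq_cube)

lemma has_derivative_rt_christoffel:
  assumes "(r has_field_derivative r') (at s)" "(F has_field_derivative F') (at s)"
    "(X has_field_derivative X') (at s)" "(Y has_field_derivative Y') (at s)"
    "r s \<noteq> 0" "F s \<noteq> 0"
  shows "((\<lambda>s. rt_christoffel a d (r s) (F s) (X s) (Y s) i j k) has_field_derivative
      rt_christoffel_deriv a d (r s) (F s) (X s) (Y s) r' F' X' Y' i j k) (at s)"
proof -
  note [derivative_intros] = assms(1-4)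
  have radial: "((\<lambda>s. d / (r s)\<^sup>2) has_field_derivative - 2 * d * r' / r s^3) (at s)"
    "((\<lambda>s. - d / (r s)\<^sup>2) has_field_derivative 2 * d * r' / r s^3) (at s)"
    "((\<lambda>s. 2 * (a - d / r s) * d / (r s)\<^sup>2) has_field_derivative
        - 4 * a * d * r' / r s^3 + 6 * d\<^sup>2 * r' / r s^4) (at s)"
    "((\<lambda>s. 1 / r s) has_field_derivative - r' / (r s)\<^sup>2) (at s)"
    using assms(5)
    by (auto intro!: derivative_eq_intros simp: field_simps eval_nat_numeral)
  have mixed: "((\<lambda>s. r s / (F s)\<^sup>2) has_field_derivative r' / (F s)\<^sup>2 - 2 * r s * F' / F s^3) (at s)"
    "((\<lambda>s. 2 * (a * r s - d) / (F s)\<^sup>2) has_field_derivative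
        2 * a * r' / (F s)\<^sup>2 - 4 * (a * r s - d) * F' / F s^3) (at s)"
    using assms(5,6)
    by (auto intro!: derivative_eq_intros simp: field_simps eval_nat_numeral)
  have angular: "((\<lambda>s. Z s / F s) has_field_derivative Z' / F s - Z s * F' / (F s)\<^sup>2) (at s)"
    "((\<lambda>s. - Z s / F s) has_field_derivative Z s * F' / (F s)\<^sup>2 - Z' / F s) (at s)"
    if "(Z has_field_derivative Z') (at s)" for Z Z'
    using assms(6) that
    by (auto intro!: derivative_eq_intros simp: field_simps eval_nat_numeral)
  show ?thesis
    unfolding rt_christoffel_def rt_christoffel_deriv_def
    using exhaust_4[of i] exhaust_4[of j] exhaust_4[of k]
      radial mixed angular[OF assms(3)] angular[OF assms(4)]
    by (elim disjE) simp_all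
qed


section \<open>The Riemann tensor\<close>

text \<open>
  The coefficients of the two-form \<open>dx\<^sup>m \<and> dx\<^sup>n\<close>. Its products express the symmetries of the
  Riemann tensor in the index pairs \<open>ij\<close> and \<open>kl\<close>.
\<close>

definition bivector :: "4 \<Rightarrow> 4 \<Rightarrow> 4 \<Rightarrow> 4 \<Rightarrow> real" where
  "bivector m n i j = (if i = m \<and> j = n then 1 else if i = n \<and> j = m then - 1 else 0)"

text \<open>
  The Riemann tensor as a quadratic form in the two-forms above, with \<open>F\<close> and \<open>K\<close> standing for the
  values of \<open>f\<close> and \<open>F\<^sub>1\<close>. In the last line \<open>K\<close> is the contribution of the intrinsic curvature of
  the surfaces of constant \<open>t\<close> and \<open>r\<close>, and \<open>- 2 * (a - d / r)\<close> that of their embedding.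
\<close>

definition rt_riemann ::
  "real \<Rightarrow> real \<Rightarrow> real \<Rightarrow> real \<Rightarrow> real \<Rightarrow> 4 \<Rightarrow> 4 \<Rightarrow> 4 \<Rightarrow> 4 \<Rightarrow> real" where
  "rt_riemann a d r F K i j k l =
     - 2 * d / r^3 * bivector 1 2 i j * bivector 1 2 k l
     + (\<Sum>m\<in>{3,4}.
          d / (r * F\<^sup>2) * (bivector 1 m i j * bivector 2 m k l + bivector 2 m i j * bivector 1 m k l)
          - 2 * (a - d / r) * d / (r * F\<^sup>2) * bivector 1 m i j * bivector 1 m k l)
     + r\<^sup>2 * (K - 2 * (a - d / r)) / F^4 * bivector 3 4 i j * bivector 3 4 k l"

text \<open>
  The algebraic part of the curvature computation, with the values of \<open>f\<close> and of its first and
  second derivatives replaced by independent reals. A single variable \<open>XY\<close> stands for both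
  mixed derivatives; with two of them the first index pair would not come out antisymmetric.
\<close>

lemma rt_riemann_contraction:
  fixes a d r F X Y XX XY YY :: real
  defines "r' k \<equiv> if k = 2 then 1 else 0"
    and "F' k \<equiv> if k = 3 then X else if k = 4 then Y else 0"
    and "X' k \<equiv> if k = 3 then XX else if k = 4 then XY else 0"
    and "Y' k \<equiv> if k = 3 then XY else if k = 4 then YY else 0"
    and "g i j \<equiv> if i = 1 \<and> j = 1 then - 2 * (a - d / r)
      else if i = 1 \<and> j = 2 \<or> i = 2 \<and> j = 1 then 1
      else if i = j \<and> (i = 3 \<or> i = 4) then - (r\<^sup>2 / F\<^sup>2) else 0"
  assumes "r \<noteq> 0" "F \<noteq> 0"
  shows "(\<Sum>\<alpha>\<in>UNIV. g i \<alpha> *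
       (rt_christoffel_deriv a d r F X Y (r' k) (F' k) (X' k) (Y' k) \<alpha> j l
        - rt_christoffel_deriv a d r F X Y (r' l) (F' l) (X' l) (Y' l) \<alpha> j k
        + (\<Sum>\<beta>\<in>UNIV. rt_christoffel a d r F X Y \<beta> j l * rt_christoffel a d r F X Y \<alpha> \<beta> k)
        - (\<Sum>\<beta>\<in>UNIV. rt_christoffel a d r F X Y \<beta> j k * rt_christoffel a d r F X Y \<alpha> \<beta> l)))
    = rt_riemann a d r F (X\<^sup>2 + Y\<^sup>2 - F * (XX + YY)) i j k l"
  using exhaust_4[of i] exhaust_4[of j] exhaust_4[of k] exhaust_4[of l] assms(6,7)
  unfolding r'_def F'_def X'_def Y'_def g_def
  by (elim disjE) (simp_all add: sum_4 rt_christoffel_def rt_christoffel_deriv_def rt_riemann_def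
      bivector_def field_simps eval_nat_numeral)

lemma riemann_rt_metric:
  assumes "open I" "open J" "open \<Omega>" "0 \<notin> J" "smooth_on \<Omega> f" "\<forall>q\<in>\<Omega>. f q \<noteq> 0"
    and p: "p \<in> rt_domain I J \<Omega>"
  shows "riemann (rt_metric a 0 d f) i j k l p =
    rt_riemann a d (p $ 2) (f (rt_xy p)) (rt_F1 f (rt_xy p)) i j k l"
proof -
  let ?M = "rt_domain I J \<Omega>"
  let ?q = "rt_xy p"
  have M: "q $ 2 \<noteq> 0" "rt_xy q \<in> \<Omega>" "f (rt_xy q) \<noteq> 0" if "q \<in> ?M" for q
    using that assms(4,6) by (auto simp: rt_domain_def)
  have christoffel: "christoffel (rt_metric a 0 d f) i j k q =
      rt_christoffel a d (q $ 2) (f (rt_xy q)) (partial 1 f (rt_xy q)) (partial 2 f (rt_xy q)) i j k"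
    if "q \<in> ?M" for i j k q
    using christoffel_rt_metric[OF M(1)[OF that] assms(5) M(2)[OF that] M(3)[OF that]] .
  have deriv: "partial m (christoffel (rt_metric a 0 d f) i j k) p =
      rt_christoffel_deriv a d (p $ 2) (f ?q) (partial 1 f ?q) (partial 2 f ?q)
        (if m = 2 then 1 else 0) (chart_partial m f ?q)
        (chart_partial m (partial 1 f) ?q) (chart_partial m (partial 2 f) ?q) i j k"
    for m i j k
  proof -
    have "partial m (christoffel (rt_metric a 0 d f) i j k) p =
      partial m (\<lambda>q. rt_christoffel a d (q $ 2) (f (rt_xy q))
        (partial 1 f (rt_xy q)) (partial 2 f (rt_xy q)) i j k) p"
      using open_rt_domain[OF assms(1-3)] p christoffel by (rule partial_cong_on_open)
    also have "\<dots> = rt_christoffel_deriv a d (p $ 2) (f ?q) (partial 1 f ?q) (partial 2 f ?q)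
        (if m = 2 then 1 else 0) (chart_partial m f ?q)
        (chart_partial m (partial 1 f) ?q) (chart_partial m (partial 2 f) ?q) i j k"
      using has_derivative_rt_christoffel[OF has_derivative_radius[of p m]
          has_derivative_rt_xy[OF assms(5) M(2)[OF p], of m]
          has_derivative_rt_xy[OF smooth_on_partial[OF assms(5)] M(2)[OF p], of 1 m]
          has_derivative_rt_xy[OF smooth_on_partial[OF assms(5)] M(2)[OF p], of 2 m]] M[OF p]
      by (intro partial_eqI) simp
    finally show ?thesis .
  qed
  have mixed: "partial 1 (partial 2 f) ?q = partial 2 (partial 1 f) ?q"
    using partial_commute[OF assms(3,5) M(2)[OF p]] .
  show ?thesis
    unfolding riemann_def deriv christoffel[OF p] rt_metric_nth rt_F1_def chart_partial_def
      partials.simps mixed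
    by (rule rt_riemann_contraction[OF M(1)[OF p] M(3)[OF p]])
qed


section \<open>Invariance along the \<open>x\<close>-direction\<close>

lemma lie_derivative4_rt_dx: "lie_derivative4 rt_dx T i j k l p = partial 3 (T i j k l) p"
proof -
  have "partial m (\<lambda>q. rt_dx q $ n) p = 0" for m n
    by (rule partial_eqI) (simp add: rt_dx_def)
  then show ?thesis
    by (simp add: lie_derivative4_def sum_4 rt_dx_def axis_def)
qed

text \<open>
  Outside the \<open>3434\<close>-component the function \<open>f\<close> enters the curvature only through terms that carry
  a factor \<open>d\<close>. In the \<open>3434\<close>-component the part \<open>2d/r\<close> of \<open>-2 (a - d / r)\<close> is split off, so that what
  remains is \<open>(F\<^sub>1 - 2a)/f\<^sup>4\<close>, which has no factor \<open>d\<close>.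
\<close>

lemma rt_riemann_decompose:
  assumes "r \<noteq> 0"
  obtains A B C D where "\<And>F K. rt_riemann a d r F K i j k l =
    A + B * (d / F\<^sup>2) + C * (d / F^4) + D * ((K - 2 * a) / F^4)"
proof -
  define w where "w m n m' n' = bivector m n i j * bivector m' n' k l" for m n m' n'
  have "rt_riemann a d r F K i j k l =
      - 2 * d / r^3 * w 1 2 1 2
    + (w 1 3 2 3 + w 2 3 1 3 + w 1 4 2 4 + w 2 4 1 4
       - 2 * (a - d / r) * (w 1 3 1 3 + w 1 4 1 4)) / r * (d / F\<^sup>2)
    + 2 * r * w 3 4 3 4 * (d / F^4) + r\<^sup>2 * w 3 4 3 4 * ((K - 2 * a) / F^4)" for F K
  proof -
    have "r\<^sup>2 * (K - 2 * (a - d / r)) / F^4 = 2 * r * (d / F^4) + r\<^sup>2 * ((K - 2 * a) / F^4)"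
      using assms by (simp add: add_divide_distrib diff_divide_distrib algebra_simps power2_eq_square)
    then show ?thesis
      unfolding rt_riemann_def
      by (simp add: w_def add_divide_distrib diff_divide_distrib algebra_simps)
  qed
  then show ?thesis by (rule that)
qed

text \<open>
  The numerator is the coefficient of \<open>r\<close> in the differential equation of the theorem. This needs
  \<open>f\<^sub>y\<^sub>y\<^sub>x = f\<^sub>x\<^sub>y\<^sub>y\<close>, obtained by two exchanges of neighbouring derivatives; the second takes place
  under the outer \<open>\<partial>\<^sub>y\<close> and so uses the symmetry on a neighbourhood of the point.
\<close>

lemma angular_curvature_x_derivative:
  assumes "open \<Omega>" "smooth_on \<Omega> f" "q \<in> \<Omega>" "f q \<noteq> 0"
  defines "fx \<equiv> partials [1] f q" and "fy \<equiv> partials [2] f q"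
    and "fxx \<equiv> partials [1,1] f q" and "fxy \<equiv> partials [1,2] f q" and "fyy \<equiv> partials [2,2] f q"
    and "fxxx \<equiv> partials [1,1,1] f q" and "fxyy \<equiv> partials [1,2,2] f q"
  shows "((\<lambda>s. (rt_F1 f (q + s *\<^sub>R axis 1 1) - 2 * a) / f (q + s *\<^sub>R axis 1 1) ^ 4)
    has_field_derivative
      (8 * a * fx - 4 * fy\<^sup>2 * fx + 3 * f q * fyy * fx - 4 * fx^3 + 2 * f q * fy * fxy
        - (f q)\<^sup>2 * fxyy + 5 * f q * fx * fxx - (f q)\<^sup>2 * fxxx) / f q ^ 5) (at 0)"
proof -
  have D: "((\<lambda>s. partials is f (q + s *\<^sub>R axis 1 1)) has_field_derivative
      partial 1 (partials is f) q) (at 0)" for "is"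
    using smooth_on_line_derivative[OF smooth_on_partials[OF assms(2)], of q 0 1] assms(3) by simp
  have swap: "partial 1 (partial 2 g) q' = partial 2 (partial 1 g) q'"
    if "smooth_on \<Omega> g" "q' \<in> \<Omega>" for g q'
    using partial_commute[OF assms(1) that] .
  have "partial 1 (partial 2 (partial 2 f)) q = partial 2 (partial 1 (partial 2 f)) q"
    using swap[OF smooth_on_partial[OF assms(2)] assms(3)] .
  also have "\<dots> = partial 2 (partial 2 (partial 1 f)) q"
    using assms(1,3) swap[OF assms(2)] by (rule partial_cong_on_open)
  finally have fxyy: "partial 1 (partial 2 (partial 2 f)) q = fxyy"
    by (simp add: fxyy_def)
  have fxy: "partial 1 (partial 2 f) q = fxy"
    using swap[OF assms(2,3)] by (simp add: fxy_def)
  note D' = D[of "[]"] D[of "[1]"] D[of "[2]"] D[of "[1,1]"] D[of "[2,2]"]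
  note [derivative_intros] = D'[unfolded partials.simps]
  show ?thesis
    unfolding rt_F1_def partials.simps
    by (rule derivative_eq_intros refl | simp add: assms(4))+
      (use assms(4) in \<open>simp add: fxy fxyy fx_def fy_def fxx_def fyy_def fxxx_def
        field_simps eval_nat_numeral\<close>)
qed

text \<open>
  The premise \<open>d f\<^sub>x = 0\<close> is the invariance of \<open>d/f\<^sup>2\<close> and \<open>d/f\<^sup>4\<close>, and the last premise that of
  \<open>(F\<^sub>1 - 2a)/f\<^sup>4\<close>.
\<close>

lemma curvature_collineation_rt_dxI:
  assumes "open I" "open J" "open \<Omega>" "0 \<notin> J" "smooth_on \<Omega> f" "\<forall>q\<in>\<Omega>. f q \<noteq> 0"
    and d: "\<And>q. q \<in> \<Omega> \<Longrightarrow> d * partial 1 f q = 0"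
    and K: "\<And>q. q \<in> \<Omega> \<Longrightarrow> ((\<lambda>s. (rt_F1 f (q + s *\<^sub>R axis 1 1) - 2 * a)
              / f (q + s *\<^sub>R axis 1 1) ^ 4) has_field_derivative 0) (at 0)"
  shows "curvature_collineation (rt_domain I J \<Omega>) (rt_metric a 0 d f) rt_dx"
  unfolding curvature_collineation_def lie_derivative4_rt_dx
proof (intro ballI allI)
  fix p i j k l
  assume p: "p \<in> rt_domain I J \<Omega>"
  let ?q = "rt_xy p"
  have q: "?q \<in> \<Omega>" "f ?q \<noteq> 0" "p $ 2 \<noteq> 0"
    using p assms(4,6) by (auto simp: rt_domain_def)
  obtain A B C D where decomp: "\<And>F K. rt_riemann a d (p $ 2) F K i j k l =
      A + B * (d / F\<^sup>2) + C * (d / F^4) + D * ((K - 2 * a) / F^4)"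
    using rt_riemann_decompose[OF q(3)] by metis
  have f: "((\<lambda>s. f (?q + s *\<^sub>R axis 1 1)) has_field_derivative partial 1 f ?q) (at 0)"
    using smooth_on_line_derivative[OF assms(5), of ?q 0 1] q(1) by simp
  have powers: "((\<lambda>s. d / f (?q + s *\<^sub>R axis 1 1) ^ n) has_field_derivative 0) (at 0)" for n
  proof (cases "d = 0")
    case False
    with d[OF q(1)] f have "((\<lambda>s. f (?q + s *\<^sub>R axis 1 1)) has_field_derivative 0) (at 0)"
      by simp
    then show ?thesis
      using q(2) by (auto intro!: derivative_eq_intros)
  qed simp
  have "partial 3 (riemann (rt_metric a 0 d f) i j k l) p =
      partial 3 (\<lambda>p. rt_riemann a d (p $ 2) (f (rt_xy p)) (rt_F1 f (rt_xy p)) i j k l) p"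
    using open_rt_domain[OF assms(1-3)] p riemann_rt_metric[OF assms(1-6)]
    by (rule partial_cong_on_open)
  also have "\<dots> = 0"
  proof (rule partial_eqI)
    have "((\<lambda>s. rt_riemann a d (p $ 2) (f (?q + s *\<^sub>R axis 1 1))
        (rt_F1 f (?q + s *\<^sub>R axis 1 1)) i j k l) has_field_derivative
        0 + B * 0 + C * 0 + D * 0) (at 0)"
      unfolding decomp
      by (intro DERIV_add DERIV_const DERIV_cmult powers K q)
    moreover have "axis 3 (1 :: real) $ (2 :: 4) = 0"
      by (simp add: axis_def)
    ultimately show "((\<lambda>s. rt_riemann a d ((p + s *\<^sub>R axis 3 1) $ 2) (f (rt_xy (p + s *\<^sub>R axis 3 1)))
        (rt_F1 f (rt_xy (p + s *\<^sub>R axis 3 1))) i j k l) has_field_derivative 0) (at 0)"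
      by (simp add: rt_xy_line)
  qed
  finally show "partial 3 (riemann (rt_metric a 0 d f) i j k l) p = 0" .
qed

lemma affine_vanishing_on_open:
  fixes A B :: real
  assumes "open J" "J \<noteq> {}" "\<And>r. r \<in> J \<Longrightarrow> A + r * B = 0"
  shows "A = 0 \<and> B = 0"
proof -
  obtain r where r: "r \<in> J" using assms(2) by blast
  have "\<not> J \<subseteq> {r}"
    using assms(1) r by (metis not_open_singleton subset_singletonD empty_iff)
  then obtain r' where r': "r' \<in> J" "r' \<noteq> r" by blast
  have "r' * B = r * B" using assms(3)[OF r] assms(3)[OF r'(1)] by linarith
  then have "B = 0" using r' by simp
  then show ?thesis using assms(3)[OF r] by simp
qed

theorem corollary4p4:
  fixes a b d :: real
    and I J :: "real set"
    and \<Omega> :: "(real^2) set"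
    and f :: "real^2 \<Rightarrow> real"
  assumes "open I" and "is_interval I" and "I \<noteq> {}"
    and "open J" and "is_interval J" and "J \<noteq> {}" and "0 \<notin> J"
    and "open \<Omega>" and "connected \<Omega>" and "\<Omega> \<noteq> {}"
    and "smooth_on \<Omega> f" and "\<forall>q\<in>\<Omega>. f q \<noteq> 0"
    and "b = 0"
    and "\<forall>p\<in>rt_domain I J \<Omega>. rt_F1 f (rt_xy p) - 2 * a \<noteq> 0"
    and "\<forall>p\<in>rt_domain I J \<Omega>. p $ 2 * rt_F1 f (rt_xy p) + 6 * d - 2 * a * p $ 2 \<noteq> 0"
    and "\<forall>p\<in>rt_domain I J \<Omega>.
      (let r = p $ 2; q = rt_xy p; f0 = f q;
           fx = partials [1] f q; fy = partials [2] f q;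
           fxx = partials [1,1] f q; fxy = partials [1,2] f q; fyy = partials [2,2] f q;
           fxxx = partials [1,1,1] f q; fxyy = partials [1,2,2] f q
       in (- 12 * d + 8 * a * r) * fx - 4 * r * fy^2 * fx + 3 * r * f0 * fyy * fx
          - 4 * r * fx^3 + 2 * r * f0 * fy * fxy - r * f0^2 * fxyy
          + 5 * r * f0 * fx * fxx - r * f0^2 * fxxx = 0)"
  shows "curvature_collineation (rt_domain I J \<Omega>) (rt_metric a b d f) rt_dx"
proof -
  let ?E = "\<lambda>q. 8 * a * partials [1] f q - 4 * (partials [2] f q)\<^sup>2 * partials [1] f q
      + 3 * f q * partials [2,2] f q * partials [1] f q - 4 * partials [1] f q ^ 3
      + 2 * f q * partials [2] f q * partials [1,2] f q - (f q)\<^sup>2 * partials [1,2,2] f q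
      + 5 * f q * partials [1] f q * partials [1,1] f q - (f q)\<^sup>2 * partials [1,1,1] f q"
  have coeffs: "- 12 * d * partials [1] f q = 0 \<and> ?E q = 0" if "q \<in> \<Omega>" for q
  proof (rule affine_vanishing_on_open[OF \<open>open J\<close> \<open>J \<noteq> {}\<close>])
    fix r assume "r \<in> J"
    obtain t where "t \<in> I" using \<open>I \<noteq> {}\<close> by blast
    let ?p = "vector [t, r, q $ 1, q $ 2] :: real^4"
    have xy: "rt_xy ?p = q" by (simp add: rt_xy_def vec_eq_iff forall_2)
    then have "?p \<in> rt_domain I J \<Omega>"
      using \<open>t \<in> I\<close> \<open>r \<in> J\<close> \<open>q \<in> \<Omega>\<close> by (simp add: rt_domain_def)
    from assms(16)[rule_format, OF this]
    show "- 12 * d * partials [1] f q + r * ?E q = 0"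
      unfolding xy Let_def by (simp only: vector_4) (simp add: algebra_simps)
  qed
  show ?thesis
    unfolding \<open>b = 0\<close>
  proof (rule curvature_collineation_rt_dxI[OF assms(1,4,8,7,11,12)])
    show "d * partial 1 f q = 0" if "q \<in> \<Omega>" for q
      using coeffs[OF that] by simp
    show "((\<lambda>s. (rt_F1 f (q + s *\<^sub>R axis 1 1) - 2 * a) / f (q + s *\<^sub>R axis 1 1) ^ 4)
        has_field_derivative 0) (at 0)" if "q \<in> \<Omega>" for q
    proof -
      have "f q \<noteq> 0" using assms(12) that by blast
      then show ?thesis
        using angular_curvature_x_derivative[OF assms(8,11) that, of a] coeffs[OF that]
        by (simp only: div_0 simp_thms)
    qed
  qed
qed

end
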